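(* Let $V$ be a convex plane polygon inscribed in a circle, and let $d$ be the diameter of the circumcircle. The discrete bicycle monodromy $M_{V,\ell}$ is elliptic for $\ell>d$, parabolic for $\ell=d$, and hyperbolic for $\ell\in(0,d)$. In the last case, the discrete bicycle transformation is a rotation about the circumcenter: every closed polygon $W$ with $\mathcal{B}_\ell(V,W)$ is the image of $V$ (vertex by vertex, $V_i\mapsto W_i$) under a rotation about the circumcenter of $V$.
   Context: A closed $k$-gon in $\mathbb{R}^2$ is a sequence of points $V_i$ with $V_{i+k}=V_i$ for all $i$. Discrete bicycle transport in the plane. Let $P,Q\in\mathbb{R}^2$, $\ell>0$, $\ell\ne|PQ|$, and let $X$ be a point with $|PX|=\ell$. Parallel translate $X$ along the vector $\overrightarrow{PQ}$ to $U=X+Q-P$ and reflect $U$ in the line $XQ$ to obtain a point $Y$, the transport of $X$ along $PQ$; then $|QY|=\ell$. In terms of unit vectors $u=(X-P)/\ell$ and $v=(Y-Q)/\ell$ one has $v=\frac{2\,u\cdot\xi}{|\xi|^2}\,\xi-u$ with $\xi=(Q-P)-\ell u$. This defines a map $m_{PQ,\ell}:S^1\to S^1$, $u\mapsto v$. The discrete bicycle monodromy is $M_{V,\ell}=m_{V_kV_1,\ell}\circ\dots\circ m_{V_1V_2,\ell}$, a Möbius (fractional-linear) transformation of $S^1\cong\mathbb{RP}^1$. It is called elliptic, parabolic or hyperbolic if it has, respectively, no, exactly one, or exactly two fixed points on $S^1$. $\mathcal{B}_\ell(V,W)$ means that for all $i$, $|V_iW_i|=\ell$ and $W_{i+1}$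 is the transport of $W_i$ along $V_iV_{i+1}$. Closed polygons $W$ with $\mathcal{B}_\ell(V,W)$ correspond to fixed points of $M_{V,\ell}$, and such a $W$ is called the image of $V$ under the discrete bicycle transformation $\mathcal{T}_\ell$. The parameter $\ell$ is taken different from all side lengths of $V$, so that the monodromy is defined. *)

theory Defs
  imports "HOL-Analysis.Analysis"
begin

text \<open>The Euclidean plane is the type \<^typ>\<open>complex\<close> with its real inner product \<open>inner\<close>;
  polygons are indexed by the integers and \<open>k\<close>-periodic.\<close>

definition closed_polygon :: "nat \<Rightarrow> (int \<Rightarrow> complex) \<Rightarrow> bool" where
  "closed_polygon k V \<longleftrightarrow> 0 < k \<and> (\<forall>i. V (i + int k) = V i)"

text \<open>Twice the signed area of the triangle \<open>ABC\<close>; its sign tells on which side of the line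
  \<open>AB\<close> the point \<open>C\<close> lies.\<close>

definition orient :: "complex \<Rightarrow> complex \<Rightarrow> complex \<Rightarrow> real" where
  "orient A B C = Re (B - A) * Im (C - A) - Im (B - A) * Re (C - A)"

text \<open>For every side \<open>V\<^sub>i V\<^sub>i\<^sub>+\<^sub>1\<close>, the remaining \<open>k - 2\<close> vertices lie strictly on one side of the line
  through it. This forces the vertices to be distinct, and rules out star polygons, multiple
  traversals and straight angles (the latter cannot occur for a polygon inscribed in a circle).\<close>

definition convex_polygon :: "nat \<Rightarrow> (int \<Rightarrow> complex) \<Rightarrow> bool" where
  "convex_polygon k V \<longleftrightarrow> closed_polygon k V \<and> 3 \<le> k \<and>
     (\<forall>i. (\<forall>j\<in>{i + 2..<i + int k}. 0 < orient (V i) (V (i + 1)) (V j)) \<or>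
          (\<forall>j\<in>{i + 2..<i + int k}. orient (V i) (V (i + 1)) (V j) < 0))"

text \<open>Reflection of \<open>U\<close> in the line \<open>AB\<close>, for \<open>A \<noteq> B\<close>.\<close>

definition reflect_line :: "complex \<Rightarrow> complex \<Rightarrow> complex \<Rightarrow> complex" where
  "reflect_line A B U =
     B + (2 * inner (U - B) (B - A) / (norm (B - A))\<^sup>2) *\<^sub>R (B - A) - (U - B)"

definition transport :: "complex \<Rightarrow> complex \<Rightarrow> complex \<Rightarrow> complex" where
  "transport P Q X = reflect_line X Q (X + Q - P)"

definition bicycle_map :: "complex \<Rightarrow> complex \<Rightarrow> real \<Rightarrow> complex \<Rightarrow> complex" where
  "bicycle_map P Q l u = (transport P Q (P + l *\<^sub>R u) - Q) /\<^sub>R l"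

lemma bicycle_map_eq:
  assumes "l > 0"
  shows "bicycle_map P Q l u =
    (let \<xi> = (Q - P) - l *\<^sub>R u in (2 * inner u \<xi> / (norm \<xi>)\<^sup>2) *\<^sub>R \<xi> - u)"
proof -
  define \<xi> where "\<xi> = (Q - P) - l *\<^sub>R u"
  have 1: "Q - (P + l *\<^sub>R u) = \<xi>" and 2: "P + l *\<^sub>R u + Q - P - Q = l *\<^sub>R u"
    by (simp_all add: \<xi>_def)
  have "bicycle_map P Q l u =
      (l *\<^sub>R ((2 * inner u \<xi> / (norm \<xi>)\<^sup>2) *\<^sub>R \<xi> - u)) /\<^sub>R l"
    unfolding bicycle_map_def transport_def reflect_line_def 1 2
    by (simp add: scaleR_diff_right mult.left_commute)
  then show ?thesis
    using assms by (simp add: \<xi>_def Let_def)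
qed

text \<open>\<^const>\<open>fold\<close> applies the maps for \<open>i = 1, \<dots>, k\<close> in this order, so the map for \<open>V\<^sub>1 V\<^sub>2\<close> is
  applied first; for a closed \<open>k\<close>-gon the last side is \<open>V\<^sub>k V\<^sub>1\<close>.\<close>

definition monodromy :: "nat \<Rightarrow> (int \<Rightarrow> complex) \<Rightarrow> real \<Rightarrow> complex \<Rightarrow> complex" where
  "monodromy k V l = fold (\<lambda>i. bicycle_map (V i) (V (i + 1)) l) [1..int k]"

definition circle_fixpoints :: "(complex \<Rightarrow> complex) \<Rightarrow> complex set" where
  "circle_fixpoints f = {u \<in> sphere 0 1. f u = u}"

definition elliptic :: "(complex \<Rightarrow> complex) \<Rightarrow> bool" where
  "elliptic f \<longleftrightarrow> circle_fixpoints f = {}"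

definition parabolic :: "(complex \<Rightarrow> complex) \<Rightarrow> bool" where
  "parabolic f \<longleftrightarrow> card (circle_fixpoints f) = 1"

definition hyperbolic :: "(complex \<Rightarrow> complex) \<Rightarrow> bool" where
  "hyperbolic f \<longleftrightarrow> card (circle_fixpoints f) = 2"

definition bicycle_rel :: "real \<Rightarrow> (int \<Rightarrow> complex) \<Rightarrow> (int \<Rightarrow> complex) \<Rightarrow> bool" where
  "bicycle_rel l V W \<longleftrightarrow>
     (\<forall>i. dist (V i) (W i) = l \<and> W (i + 1) = transport (V i) (V (i + 1)) (W i))"

definition rotation_about :: "complex \<Rightarrow> real \<Rightarrow> complex \<Rightarrow> complex" where
  "rotation_about c \<theta> z = c + cis \<theta> * (z - c)"

end

theory Submission
  imports Defs
begin

text \<open>Write the vertices as \<open>V\<^sub>i = c + r v\<^sub>i\<close> with \<open>\<bar>v\<^sub>i\<bar> = 1\<close> and describe a direction at \<open>V\<^sub>i\<close> in the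
  frame that turns with the radius, \<open>u = v\<^sub>i t\<close>. Let \<open>\<delta> = 2r/l\<close>. Along a side with
  \<open>v\<^sub>i\<^sub>+\<^sub>1 = v\<^sub>i cis (2\<phi>)\<close> the bicycle map becomes \<open>t \<mapsto> t cnj E / E\<close> where
  \<open>E = cos \<phi> + \<i> sin \<phi> (1 + \<delta> t)\<close> (\<open>bicycle_map_chord\<close>). All these Moebius maps come from the
  matrices \<open>cos \<phi> + sin \<phi> J\<close> with one and the same \<open>J\<close>, where \<open>J\<^sup>2 = \<kappa> = \<delta>\<^sup>2 - 1\<close>. So they commute, and
  the monodromy is given by the product \<open>\<Prod>\<^sub>j (cos \<phi>\<^sub>j + sin \<phi>\<^sub>j J) = A + B J\<close>
  (\<open>fold_bicycle_maps_on_circle\<close>). Unless \<open>B = 0\<close>, its fixed points on the circle are those of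
  \<open>J\<close>, namely the \<open>t\<close> with \<open>Re t = -1/\<delta> = -l/(2r)\<close>. The vertical line at this abscissa meets the
  unit circle in no, one or two points according as \<open>l\<close> exceeds, equals or is less than \<open>2r\<close>.

  The heart of the matter is that \<open>B \<noteq> 0\<close>, and this is where convexity enters: the half-angles \<open>\<phi>\<^sub>j\<close>
  are all of one sign and add up to \<open>\<pm>\<pi>\<close> (\<open>convex_cyclic_polygon_half_angles\<close>); reversing all of
  them only changes the sign of \<open>B\<close>, so let them be positive. For \<open>\<kappa> = -1\<close> the product is
  \<open>cos \<pi> + sin \<pi> J = -1\<close> and \<open>B\<close> vanishes; for every \<open>\<kappa> > -1\<close>, \<open>chord_coeffs_positive\<close> shows \<open>B > 0\<close>
  by comparing the partial products for \<open>\<kappa>\<close> with those for \<open>-1\<close>.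

  A closed polygon \<open>W\<close> related to \<open>V\<close> starts at a fixed point of the monodromy, hence at some \<open>t\<close>
  fixed by \<open>J\<close>, so that every single step fixes \<open>t\<close> too. Thus \<open>W\<^sub>i = V\<^sub>i + l v\<^sub>i t\<close> for all \<open>i\<close>, that is
  \<open>W\<^sub>i - c = (1 + l t / r) (V\<^sub>i - c)\<close>, and \<open>Re t = -l/(2r)\<close> makes the factor \<open>1 + l t / r\<close> unimodular.\<close>

section \<open>The bicycle map along a chord of a circle\<close>

text \<open>Reflecting \<open>u\<close> in the line spanned by \<open>\<xi>\<close> yields \<open>cnj u \<xi> / cnj \<xi>\<close>, which is a fractional
  linear function of \<open>u\<close> because \<open>cnj u = 1 / u\<close> on the unit circle.\<close>

lemma bicycle_map_moebius:
  assumes "l > 0" "norm u = 1" "dist P Q \<noteq> l"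
  shows "bicycle_map P Q l u =
    (of_real l * u - (Q - P)) / (of_real l - cnj (Q - P) * u)"
proof -
  define \<xi> where "\<xi> = (Q - P) - l *\<^sub>R u"
  have \<xi>0: "\<xi> \<noteq> 0"
  proof
    assume "\<xi> = 0"
    then have "norm (Q - P) = norm (l *\<^sub>R u)" by (simp add: \<xi>_def)
    then show False using assms by (simp add: dist_norm norm_minus_commute)
  qed
  have uu: "u * cnj u = 1"
    using assms(2) by (simp add: complex_norm_square[symmetric])
  have u0: "u \<noteq> 0" using assms(2) by auto
  have inn: "complex_of_real (2 * inner u \<xi>) = u * cnj \<xi> + cnj u * \<xi>"
    by (simp add: complex_eq_iff inner_complex_def algebra_simps)
  have cancel: "p / (x * y) * x = p / y" if "x \<noteq> 0" for p x y :: complex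
    using that by simp
  have "bicycle_map P Q l u = of_real (2 * inner u \<xi>) / of_real ((norm \<xi>)\<^sup>2) * \<xi> - u"
    unfolding bicycle_map_eq[OF assms(1)] by (simp add: \<xi>_def Let_def scaleR_conv_of_real)
  also have "\<dots> = (u * cnj \<xi> + cnj u * \<xi>) / (\<xi> * cnj \<xi>) * \<xi> - u"
    by (simp only: inn complex_norm_square)
  also have "\<dots> = (u * cnj \<xi> + cnj u * \<xi>) / cnj \<xi> - u"
    by (simp only: cancel[OF \<xi>0])
  also have "\<dots> = cnj u * \<xi> / cnj \<xi>"
    using \<xi>0 by (simp add: field_simps)
  also have "\<dots> = (u * cnj u) * \<xi> / (u * cnj \<xi>)"
    using u0 by simp
  also have "\<dots> = \<xi> / (u * cnj \<xi>)" by (simp add: uu)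
  also have "u * cnj \<xi> = cnj (Q - P) * u - of_real l * (u * cnj u)"
    by (simp add: \<xi>_def algebra_simps scaleR_conv_of_real)
  also have "\<xi> / (cnj (Q - P) * u - of_real l * (u * cnj u)) =
      (of_real l * u - (Q - P)) / (of_real l - cnj (Q - P) * u)"
    unfolding uu \<xi>_def by (simp add: scaleR_conv_of_real minus_divide_divide[symmetric, of "Q - P - _"])
  finally show ?thesis .
qed

text \<open>This is the denominator of the Moebius map of \<open>A + B J\<close>, restricted to the unit circle; its
  numerator is there \<open>t\<close> times the complex conjugate of the denominator.\<close>

definition chord_factor :: "real \<Rightarrow> real \<Rightarrow> real \<Rightarrow> complex \<Rightarrow> complex" where
  "chord_factor \<delta> A B t = of_real A + \<i> * of_real B * (1 + of_real \<delta> * t)"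

text \<open>The chord from \<open>v\<close> to \<open>v cis (2\<phi>)\<close> is \<open>v cis \<phi>\<close> times \<open>2 \<i> sin \<phi>\<close>; taking \<open>l v cis \<phi>\<close>
  out of the numerator of the fractional linear form and \<open>l cis (-\<phi>)\<close> out of its denominator leaves
  \<open>t cnj E\<close> and \<open>E\<close>. The denominator can vanish only if \<open>\<delta> \<bar>sin \<phi>\<bar> = 1\<close>, that is, if the chord has length
  \<open>l\<close>.\<close>

lemma bicycle_map_chord:
  fixes c v t :: complex and r l \<phi> :: real
  defines "\<delta> \<equiv> 2 * r / l"
  defines "E \<equiv> chord_factor \<delta> (cos \<phi>) (sin \<phi>) t"
  assumes l: "l > 0" and r: "r > 0" and v: "norm v = 1" and t: "norm t = 1"
    and ne: "dist (c + of_real r * v) (c + of_real r * (v * cis (2 * \<phi>))) \<noteq> l"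
  shows "E \<noteq> 0"
    and "bicycle_map (c + of_real r * v) (c + of_real r * (v * cis (2 * \<phi>))) l (v * t) =
      v * cis (2 * \<phi>) * (t * cnj E / E)"
proof -
  define e where "e = cis \<phi>"
  define a where "a = of_real r * (v * cis (2 * \<phi>)) - of_real r * v"
  have ee: "e * cnj e = 1" by (simp add: e_def cis_cnj cis_mult)
  have vv: "cnj v * v = 1" using v by (simp add: complex_norm_square[symmetric] mult.commute)
  have tt: "t * cnj t = 1" using t by (simp add: complex_norm_square[symmetric])
  have e2: "cis (2 * \<phi>) = e * e" by (simp add: e_def cis_mult)
  have s: "e - cnj e = 2 * \<i> * of_real (sin \<phi>)"
    by (simp add: e_def complex_eq_iff)
  have a: "a = v * e * (2 * \<i> * of_real (r * sin \<phi>))"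
  proof -
    have "a = of_real r * v * (e * e - e * cnj e)" unfolding a_def e2 ee by (simp add: algebra_simps)
    also have "\<dots> = of_real r * v * e * (e - cnj e)" by (simp add: algebra_simps)
    finally show ?thesis unfolding s by simp
  qed
  have ld: "of_real l * complex_of_real \<delta> = 2 * of_real r"
    using l by (simp add: \<delta>_def)
  have E: "E = e + \<i> * of_real (sin \<phi> * \<delta>) * t"
    by (simp add: E_def chord_factor_def e_def complex_eq_iff algebra_simps)
  have na: "norm a \<noteq> l"
    using ne by (simp add: a_def dist_norm norm_minus_commute)
  show E0: "E \<noteq> 0"
  proof
    assume "E = 0"
    then have "norm e = norm (\<i> * of_real (sin \<phi> * \<delta>) * t)"
      unfolding E by (metis add_eq_0_iff norm_minus_cancel)
    moreover have "\<delta> > 0" using l r by (simp add: \<delta>_def)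
    ultimately have "\<bar>sin \<phi>\<bar> * \<delta> = 1"
      using t by (simp add: e_def norm_mult abs_mult)
    moreover have "norm a = 2 * r * \<bar>sin \<phi>\<bar>"
      unfolding a using v r by (simp add: norm_mult e_def abs_mult)
    ultimately show False using na l by (simp add: \<delta>_def field_simps)
  qed
  have num: "of_real l * (v * t) - a = v * e * of_real l * (t * cnj E)"
  proof -
    have "v * e * of_real l * (t * cnj E) =
        v * of_real l * t * (e * cnj e) - \<i> * v * e * of_real (sin \<phi>) * (of_real l * of_real \<delta>) * (t * cnj t)"
      unfolding E by (simp add: algebra_simps)
    also have "\<dots> = of_real l * (v * t) - a"
      unfolding ee tt ld a by (simp add: algebra_simps)
    finally show ?thesis by simp
  qed
  have den: "of_real l - cnj a * (v * t) = cnj e * of_real l * E"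
  proof -
    have "cnj e * of_real l * E = of_real l * (e * cnj e) + cnj e * \<i> * of_real (sin \<phi>) * (of_real l * of_real \<delta>) * t"
      unfolding E by (simp add: algebra_simps)
    also have "\<dots> = of_real l + 2 * \<i> * of_real (r * sin \<phi>) * cnj e * t"
      unfolding ee ld by (simp add: algebra_simps)
    also have "\<dots> = of_real l - cnj a * (v * t)"
    proof -
      have "cnj a * (v * t) = - (2 * \<i> * of_real (r * sin \<phi>) * cnj e * t * (cnj v * v))"
        unfolding a by (simp add: algebra_simps)
      then show ?thesis unfolding vv by simp
    qed
    finally show ?thesis by simp
  qed
  have e0: "e \<noteq> 0" by (simp add: e_def)
  have inv: "1 / cnj e = e" using e0 ee by (simp add: field_simps)
  have "bicycle_map (c + of_real r * v) (c + of_real r * (v * cis (2 * \<phi>))) l (v * t) =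
     (of_real l * (v * t) - a) / (of_real l - cnj a * (v * t))"
    using bicycle_map_moebius[OF l _ ne, of "v * t"] v t by (simp add: norm_mult a_def)
  also have "\<dots> = v * e * (1 / cnj e) * (t * cnj E / E)"
    unfolding num den using l by simp
  finally show "bicycle_map (c + of_real r * v) (c + of_real r * (v * cis (2 * \<phi>))) l (v * t) =
      v * cis (2 * \<phi>) * (t * cnj E / E)"
    unfolding inv e2 by (simp add: mult.assoc)
qed

section \<open>Composition of the maps of consecutive chords\<close>

text \<open>The pair \<open>(A, B)\<close> with \<open>A + B J = \<Prod>\<^sub>j\<^sub><\<^sub>m (cos \<phi>\<^sub>j + sin \<phi>\<^sub>j J)\<close> in \<open>\<real>[J]/(J\<^sup>2 - \<kappa>)\<close>.\<close>

primrec chord_coeffs :: "real \<Rightarrow> (nat \<Rightarrow> real) \<Rightarrow> nat \<Rightarrow> real \<times> real" where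
  "chord_coeffs \<kappa> \<phi> 0 = (1, 0)"
| "chord_coeffs \<kappa> \<phi> (Suc m) = (case chord_coeffs \<kappa> \<phi> m of (A, B) \<Rightarrow>
     (A * cos (\<phi> m) + \<kappa> * B * sin (\<phi> m), B * cos (\<phi> m) + A * sin (\<phi> m)))"

lemma chord_coeffs_uminus:
  "chord_coeffs \<kappa> (\<lambda>j. - \<phi> j) m = apsnd uminus (chord_coeffs \<kappa> \<phi> m)"
  by (induction m) (auto split: prod.splits)

text \<open>Composing Moebius maps multiplies their matrices, so the denominators form a cocycle: the
  denominator of a composite is the product of the denominators along the way. Here
  \<open>J\<^sup>2 = \<delta>\<^sup>2 - 1\<close>.\<close>

lemma chord_factor_mult:
  fixes A B \<delta> \<phi> :: real and t :: complex
  defines "F \<equiv> chord_factor \<delta> A B t"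
  assumes t: "norm t = 1" and F: "F \<noteq> 0"
  shows "chord_factor \<delta> (cos \<phi>) (sin \<phi>) (t * cnj F / F) * F =
    chord_factor \<delta> (A * cos \<phi> + (\<delta>\<^sup>2 - 1) * B * sin \<phi>) (B * cos \<phi> + A * sin \<phi>) t"
proof -
  have tt: "t * cnj t = 1" using t by (simp add: complex_norm_square[symmetric])
  have tF: "t * cnj F = (of_real A - \<i> * of_real B) * t - \<i> * of_real B * of_real \<delta> * (t * cnj t)"
    by (simp add: F_def chord_factor_def algebra_simps)
  have "chord_factor \<delta> (cos \<phi>) (sin \<phi>) (t * cnj F / F) * F =
     of_real (cos \<phi>) * F + \<i> * of_real (sin \<phi>) * (F + of_real \<delta> * (t * cnj F))"
    using F by (simp add: chord_factor_def field_simps)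
  also have "\<dots> = chord_factor \<delta> (A * cos \<phi> + (\<delta>\<^sup>2 - 1) * B * sin \<phi>) (B * cos \<phi> + A * sin \<phi>) t"
    unfolding tF tt unfolding F_def chord_factor_def
    by (simp add: complex_eq_iff algebra_simps power2_eq_square)
  finally show ?thesis .
qed

text \<open>The angles \<open>2 \<theta> m\<close> locate the vertices as seen from the circumcenter, so the half-angle of the
  side after vertex \<open>m\<close> is \<open>\<theta> (m + 1) - \<theta> m\<close>. The cocycle identity turns the sequence of steps into
  a single map of the same shape. In the induction the non-vanishing of the denominator has to be
  carried along; it is inherited from the single steps.\<close>

lemma fold_bicycle_maps_on_circle:
  fixes V :: "int \<Rightarrow> complex" and \<theta> \<phi> :: "nat \<Rightarrow> real"
  defines "AB \<equiv> \<lambda>\<delta> m. chord_coeffs (\<delta>\<^sup>2 - 1) (\<lambda>j. \<theta> (Suc j) - \<theta> j) m"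
  defines "F \<equiv> \<lambda>\<delta> t m. chord_factor \<delta> (fst (AB \<delta> m)) (snd (AB \<delta> m)) t"
  assumes l: "l > 0" and r: "r > 0" and v: "norm v = 1" and t: "norm t = 1"
    and V: "\<And>m. m \<le> k \<Longrightarrow> V (1 + int m) = c + of_real r * (v * cis (2 * \<theta> m))"
    and \<theta>0: "\<theta> 0 = 0"
    and ne: "\<And>i. l \<noteq> dist (V i) (V (i + 1))"
  shows "m \<le> k \<Longrightarrow> F (2 * r / l) t m \<noteq> 0 \<and>
    fold (\<lambda>i. bicycle_map (V i) (V (i + 1)) l) [1..int m] (v * t) =
      v * cis (2 * \<theta> m) * (t * cnj (F (2 * r / l) t m) / F (2 * r / l) t m)"
proof (induction m)
  case 0
  then show ?case using \<theta>0 by (simp add: F_def AB_def chord_factor_def)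
next
  case (Suc m)
  define \<delta> where "\<delta> = 2 * r / l"
  define \<phi> where "\<phi> = \<theta> (Suc m) - \<theta> m"
  define G where "G = F \<delta> t m"
  define w where "w = v * cis (2 * \<theta> m)"
  define s where "s = t * cnj G / G"
  from Suc have G0: "G \<noteq> 0"
    and IH: "fold (\<lambda>i. bicycle_map (V i) (V (i + 1)) l) [1..int m] (v * t) = w * s"
    by (simp_all add: G_def \<delta>_def w_def s_def)
  have nw: "norm w = 1" using v by (simp add: w_def norm_mult)
  have ns: "norm s = 1" using t G0 by (simp add: s_def norm_mult norm_divide)
  have V1: "V (1 + int m) = c + of_real r * w"
    using V[of m] Suc.prems by (simp add: w_def)
  have w': "w * cis (2 * \<phi>) = v * cis (2 * \<theta> (Suc m))"
    unfolding w_def \<phi>_def mult.assoc cis_mult by (simp add: algebra_simps)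
  have V2: "V (1 + int m + 1) = c + of_real r * (w * cis (2 * \<phi>))"
    using V[of "Suc m"] Suc.prems unfolding w' by (simp add: add.commute add.left_commute)
  have ne': "dist (c + of_real r * w) (c + of_real r * (w * cis (2 * \<phi>))) \<noteq> l"
    using ne[of "1 + int m"] unfolding V1 V2 by metis
  define E where "E = chord_factor \<delta> (cos \<phi>) (sin \<phi>) s"
  note step = bicycle_map_chord[OF l r nw ns ne', folded \<delta>_def, folded E_def]
  have EG: "E * G = F \<delta> t (Suc m)"
    unfolding E_def s_def
    using chord_factor_mult[OF t, of \<delta> "fst (AB \<delta> m)" "snd (AB \<delta> m)" \<phi>] G0
    by (simp add: G_def F_def AB_def \<phi>_def split: prod.splits)
  have list: "[1..int (Suc m)] = [1..int m] @ [1 + int m]"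
    using upto_rec2[of 1 "int (Suc m)"] by simp
  have "fold (\<lambda>i. bicycle_map (V i) (V (i + 1)) l) [1..int (Suc m)] (v * t) =
      w * cis (2 * \<phi>) * (s * cnj E / E)"
    unfolding list fold_append comp_def IH using step(2) by (simp add: V1 V2[simplified])
  also have "s * cnj E / E = t * cnj (E * G) / (E * G)"
    by (simp add: s_def mult_ac)
  finally show ?case
    using step(1) G0 unfolding EG w' \<delta>_def[symmetric] by (metis EG mult_eq_0_iff)
qed

section \<open>The composite along a convex polygon is not the identity\<close>

text \<open>For \<open>\<kappa> = -1\<close> the partial product would be \<open>cos (S m) + sin (S m) J\<close>. The determinant
  \<open>D = A sin S - B cos S\<close> measures the deviation from it. Passing to the next factor, with angle
  \<open>\<psi>\<close>, obeys two identities,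
  \<open>D' = D + (1 + \<kappa>) B sin \<psi> sin (S + \<psi>)\<close> and \<open>B' sin S = D sin \<psi> + B sin (S + \<psi>)\<close>.
  As long as \<open>S\<close> stays in \<open>(0, \<pi>)\<close> they propagate \<open>B > 0\<close> and \<open>D \<ge> 0\<close>, and \<open>D\<close> becomes positive
  from the second factor on. At the end \<open>S = \<pi>\<close>, where \<open>D = B\<close> and the first identity reduces to
  \<open>D' = D\<close>. So \<open>B\<close> equals the value of \<open>D\<close> before the last factor, which is positive because there
  are at least three factors.\<close>

lemma chord_coeffs_positive:
  fixes S :: "nat \<Rightarrow> real"
  assumes \<kappa>: "\<kappa> > - 1" and k: "k \<ge> 3"
    and S0: "S 0 = 0" and Sk: "S k = pi" and inc: "\<And>m. m < k \<Longrightarrow> S m < S (Suc m)"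
  shows "snd (chord_coeffs \<kappa> (\<lambda>j. S (Suc j) - S j) k) > 0"
proof -
  define A where "A m = fst (chord_coeffs \<kappa> (\<lambda>j. S (Suc j) - S j) m)" for m
  define B where "B m = snd (chord_coeffs \<kappa> (\<lambda>j. S (Suc j) - S j) m)" for m
  define D where "D m = A m * sin (S m) - B m * cos (S m)" for m
  define s where "s m = sin (S (Suc m) - S m)" for m
  define x where "x m = cos (S (Suc m) - S m)" for m
  have A': "A (Suc m) = A m * x m + \<kappa> * B m * s m"
    and B': "B (Suc m) = B m * x m + A m * s m" for m
    by (simp_all add: A_def B_def s_def x_def split: prod.splits)
  have sin': "sin (S (Suc m)) = sin (S m) * x m + cos (S m) * s m"
    and cos': "cos (S (Suc m)) = cos (S m) * x m - sin (S m) * s m" for m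
    using sin_add[of "S m" "S (Suc m) - S m"] cos_add[of "S m" "S (Suc m) - S m"]
    by (simp_all add: s_def x_def)
  have sx: "(x m)\<^sup>2 = 1 - (s m)\<^sup>2" for m
    by (simp add: s_def x_def cos_squared_eq)
  have D': "D (Suc m) = D m + (1 + \<kappa>) * B m * s m * sin (S (Suc m))" for m
  proof -
    have "D (Suc m) = A m * sin (S m) * ((x m)\<^sup>2 + (s m)\<^sup>2) - B m * cos (S m) * (x m)\<^sup>2
        + \<kappa> * B m * (s m)\<^sup>2 * cos (S m) + (1 + \<kappa>) * B m * s m * x m * sin (S m)"
      unfolding D_def A' B' sin' cos' by (simp add: algebra_simps power2_eq_square)
    then show ?thesis
      unfolding D_def sin' sx by (simp add: algebra_simps power2_eq_square)
  qed
  have BD: "B (Suc m) * sin (S m) = s m * D m + B m * sin (S (Suc m))" for m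
    unfolding D_def B' sin' by (simp add: algebra_simps)
  have mono: "S i < S j" if "i < j" "j \<le> k" for i j
    using that
  proof (induction j)
    case (Suc j)
    then show ?case using inc[of j] by (cases "i = j") (auto simp: less_Suc_eq)
  qed simp
  have Spos: "0 < S m" "S m < pi" if "0 < m" "m < k" for m
    using mono[of 0 m] mono[of m k] that S0 Sk by auto
  have sinS: "sin (S m) > 0" if "0 < m" "m < k" for m
    using Spos[OF that] by (rule sin_gt_zero)
  have spos: "s m > 0" if "Suc m < k" for m
    unfolding s_def using Spos[of "Suc m"] inc[of m] that S0 Spos[of m]
    by (intro sin_gt_zero; cases m) auto
  have inv: "B (Suc m) > 0 \<and> D (Suc m) \<ge> 0 \<and> (m > 0 \<longrightarrow> D (Suc m) > 0)" if "Suc m < k" for m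
    using that
  proof (induction m)
    case 0
    then show ?case using spos[of 0] by (simp add: A_def B_def D_def s_def S0)
  next
    case (Suc m)
    then have IH: "B (Suc m) > 0" "D (Suc m) \<ge> 0" by auto
    have pos: "sin (S (Suc m)) > 0" "sin (S (Suc (Suc m))) > 0" "s (Suc m) > 0"
      using Suc.prems by (auto intro: sinS spos)
    have "B (Suc (Suc m)) * sin (S (Suc m)) > 0"
      unfolding BD using IH pos by (intro add_nonneg_pos) auto
    then have "B (Suc (Suc m)) > 0" using pos by (simp add: zero_less_mult_iff)
    moreover have "D (Suc (Suc m)) > 0"
      unfolding D'[of "Suc m"] using IH pos \<kappa> by (intro add_nonneg_pos) auto
    ultimately show ?case by simp
  qed
  obtain n where n: "k = Suc (Suc n)" "n > 0"
    using k by (metis One_nat_def Suc_le_D numeral_3_eq_3 Suc_le_mono le_zero_eq not_gr_zero not_one_le_zero)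
  have "B k = D k" by (simp add: D_def Sk)
  also have "\<dots> = D (Suc n)" using D'[of "Suc n"] n Sk by simp
  also have "\<dots> > 0" using inv[of n] n by simp
  finally show ?thesis by (simp add: B_def)
qed

section \<open>Central angles of a convex inscribed polygon\<close>

lemma orient_cis:
  "orient (c + of_real r * (v * cis (2 * a))) (c + of_real r * (v * cis (2 * b)))
     (c + of_real r * (v * cis (2 * e))) =
   4 * r\<^sup>2 * (norm v)\<^sup>2 * sin (b - a) * sin (e - b) * sin (e - a)"
proof -
  have "orient (c + of_real r * (v * p)) (c + of_real r * (v * q)) (c + of_real r * (v * s)) =
    r\<^sup>2 * (norm v)\<^sup>2 * orient p q s" for p q s
    unfolding orient_def cmod_power2 by (simp add: algebra_simps power2_eq_square)
  moreover have "orient (cis (2*a)) (cis (2*b)) (cis (2*e)) = 4 * sin (b - a) * sin (e - b) * sin (e - a)"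
  proof -
    have *: "orient (cis (2*a)) (cis (2*b)) (cis (2*e)) =
      sin (2 * (b - a)) + sin (2 * (e - b)) - sin (2 * (e - a))"
      unfolding orient_def by (simp add: algebra_simps sin_diff cos_diff)
    have ea: "e - a = (b - a) + (e - b)" by simp
    show ?thesis unfolding * ea sin_double sin_add cos_add
      using sin_cos_squared_add[of "b - a"] sin_cos_squared_add[of "e - b"] by algebra
  qed
  ultimately show ?thesis by simp
qed

text \<open>The sign of the side \<open>i\<close> is read off at the vertex \<open>i + 2\<close>. The triangle \<open>V\<^sub>i V\<^sub>i\<^sub>+\<^sub>1 V\<^sub>i\<^sub>+\<^sub>2\<close> is also seen
  from the next side, since \<open>V\<^sub>i = V\<^sub>i\<^sub>+\<^sub>k\<close>, so neighbouring sides have the same sign.\<close>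

lemma convex_polygon_same_orientation:
  assumes "convex_polygon k V"
  obtains \<sigma> :: real where "\<sigma> \<in> {1, -1}"
    "\<And>i j. j \<in> {i + 2..<i + int k} \<Longrightarrow> 0 < \<sigma> * orient (V i) (V (i + 1)) (V j)"
proof -
  have k: "k \<ge> 3" and per: "V (i + int k) = V i" for i
    using assms by (auto simp: convex_polygon_def closed_polygon_def)
  have all: "(\<forall>j\<in>{i + 2..<i + int k}. 0 < \<sigma> * orient (V i) (V (i + 1)) (V j))
      \<longleftrightarrow> 0 < \<sigma> * orient (V i) (V (i + 1)) (V (i + 2))" if "\<sigma> \<in> {1, -1}" for i and \<sigma> :: real
  proof -
    have "i + 2 \<in> {i + 2..<i + int k}" using k by simp
    then show ?thesis
      using assms that unfolding convex_polygon_def by (fastforce dest: spec[of _ i])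
  qed
  define g where "g i = orient (V i) (V (i + 1)) (V (i + 2))" for i
  have g0: "g i \<noteq> 0" for i
  proof -
    have "i + 2 \<in> {i + 2..<i + int k}" using k by simp
    then show ?thesis
      using assms unfolding convex_polygon_def g_def by (fastforce dest: spec[of _ i])
  qed
  define \<sigma> where "\<sigma> = sgn (g 0)"
  have \<sigma>: "\<sigma> \<in> {1, -1}" using g0[of 0] by (auto simp: \<sigma>_def sgn_if)
  have step: "0 < \<sigma> * g i \<longleftrightarrow> 0 < \<sigma> * g (i + 1)" for i
  proof -
    \<comment> \<open>The converse implication comes from this one for the opposite sign, as no \<open>g i\<close> is zero.\<close>
    have "0 < \<sigma> * g (i + 1) \<longrightarrow> 0 < \<sigma> * g i" if "\<sigma> \<in> {1, -1}" for \<sigma> :: real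
    proof
      assume "0 < \<sigma> * g (i + 1)"
      then have "\<forall>j\<in>{i + 1 + 2..<i + 1 + int k}. 0 < \<sigma> * orient (V (i + 1)) (V (i + 1 + 1)) (V j)"
        using all[OF that, of "i + 1"] by (simp add: g_def)
      moreover have "i + int k \<in> {i + 1 + 2..<i + 1 + int k}" using k by simp
      ultimately have "0 < \<sigma> * orient (V (i + 1)) (V (i + 2)) (V i)"
        by (metis per add.assoc one_add_one)
      also have "orient (V (i + 1)) (V (i + 2)) (V i) = g i"
        by (simp add: g_def orient_def algebra_simps)
      finally show "0 < \<sigma> * g i" .
    qed
    from this[of \<sigma>] this[of "- \<sigma>"] \<sigma> g0[of i] g0[of "i + 1"] show ?thesis
      by (auto simp: zero_less_mult_iff mult_less_0_iff)
  qed
  have "0 < \<sigma> * g i" for i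
  proof (induction i rule: int_induct[of _ 0])
    case base
    then show ?case using g0[of 0] by (auto simp: \<sigma>_def sgn_if)
  next
    case (step1 i)
    then show ?case using step[of i] by simp
  next
    case (step2 i)
    then show ?case using step[of "i - 1"] by simp
  qed
  then show ?thesis using that[of \<sigma>] \<sigma> all[OF \<sigma>] by (auto simp: g_def)
qed

text \<open>Measure the central angles from the first vertex in the sense of the orientation \<open>\<sigma>\<close>, with
  values in \<open>[0, 2\<pi>)\<close>; \<open>S m\<close> is half of the angle of the vertex \<open>1 + m\<close>. The area of the triangle
  formed by a side and the first vertex, taken with the sign \<open>\<sigma>\<close>, is a positive multiple of
  \<open>sin (S (m + 1) - S m) sin (S (m + 1)) sin (S m)\<close>. As the \<open>S m\<close> lie in \<open>[0, \<pi>)\<close>, positivity of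
  all these areas forces them to increase. The first vertex is counted once more at the end, with
  half-angle \<open>\<pi>\<close>.\<close>

lemma convex_cyclic_polygon_half_angles:
  assumes cv: "convex_polygon k V" and circ: "\<forall>i. V i \<in> sphere c r"
  obtains v :: complex and \<sigma> :: real and S :: "nat \<Rightarrow> real"
  where "r > 0" "norm v = 1" "\<sigma> \<in> {1, -1}" "S 0 = 0" "S k = pi"
    "\<And>m. m < k \<Longrightarrow> S m < S (Suc m)"
    "\<And>m. m \<le> k \<Longrightarrow> V (1 + int m) = c + of_real r * (v * cis (2 * (\<sigma> * S m)))"
proof -
  have k: "k \<ge> 3" and per: "V (i + int k) = V i" for i
    using cv by (auto simp: convex_polygon_def closed_polygon_def)
  obtain \<sigma> :: real where \<sigma>: "\<sigma> \<in> {1, -1}"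
    and or: "\<And>i j. j \<in> {i + 2..<i + int k} \<Longrightarrow> 0 < \<sigma> * orient (V i) (V (i + 1)) (V j)"
    using convex_polygon_same_orientation[OF cv] by metis
  have nV: "norm (V i - c) = r" for i
    using circ by (auto simp: dist_norm norm_minus_commute)
  have r: "r > 0"
  proof (rule ccontr)
    assume "\<not> r > 0"
    then have "V i = c" for i using nV[of i] norm_ge_zero[of "V i - c"] by (simp add: not_less)
    then show False using or[of 2 0] k by (simp add: orient_def)
  qed
  define v where "v = (V 1 - c) / of_real r"
  have v: "norm v = 1" using nV[of 1] r by (simp add: v_def norm_divide)
  define z where "z i = (V i - c) / of_real r / v" for i
  have nz: "norm (z i) = 1" for i using nV[of i] r v by (auto simp: z_def norm_divide norm_mult)
  have Vz: "V i = c + of_real r * (v * z i)" for i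
    using r v by (auto simp: z_def)
  define y where "y i = (if \<sigma> = 1 then z i else cnj (z i))" for i
  have ny: "norm (y i) = 1" for i using nz[of i] by (simp add: y_def)
  define S where "S m = (if m = k then pi else Arg2pi (y (1 + int m)) / 2)" for m
  have yS: "y (1 + int m) = cis (2 * S m)" if "m < k" for m
    using Arg2pi_eq[of "y (1 + int m)"] ny[of "1 + int m"] that
    by (simp add: S_def cis_conv_exp)
  have zS: "z (1 + int m) = cis (2 * (\<sigma> * S m))" if "m < k" for m
    using yS[OF that] \<sigma> by (auto simp: y_def cis_cnj complex_eq_iff split: if_splits)
  have z1: "z 1 = 1"
    using r v by (auto simp: z_def v_def)
  have S0: "S 0 = 0" using k z1 by (auto simp: S_def y_def Arg2pi_eq_0)
  have Sk: "S k = pi" by (simp add: S_def)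
  have VS: "V (1 + int m) = c + of_real r * (v * cis (2 * (\<sigma> * S m)))" if "m \<le> k" for m
  proof (cases "m = k")
    case True
    have "cis (2 * (\<sigma> * S k)) = 1" using \<sigma> by (auto simp: Sk complex_eq_iff)
    then show ?thesis using True per[of 1] Vz[of 1] z1 by simp
  next
    case False
    then show ?thesis using Vz[of "1 + int m"] zS[of m] that by simp
  qed
  have Sr: "0 \<le> S m" "S m < pi" if "m < k" for m
    using that Arg2pi[of "y (1 + int m)"] by (auto simp: S_def)
  have tri: "0 < sin (S (Suc m) - S m) * sin (S (Suc m)) * sin (S m)" if "0 < m" "Suc m < k" for m
  proof -
    have "0 < \<sigma> * orient (V (1 + int m)) (V (1 + int m + 1)) (V (1 + int k))"
      using that by (intro or) auto
    also have "1 + int m + 1 = 1 + int (Suc m)" by simp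
    also have "V (1 + int k) = V (1 + int 0)" using per[of 1] by (simp add: add.commute)
    also have "\<sigma> * orient (V (1 + int m)) (V (1 + int (Suc m))) (V (1 + int 0)) =
      4 * r\<^sup>2 * (sin (S (Suc m) - S m) * sin (S (Suc m)) * sin (S m))"
    proof -
      \<comment> \<open>The product of three odd functions contributes \<open>\<sigma>\<^sup>3 = \<sigma>\<close>, which cancels the leading \<open>\<sigma>\<close>.\<close>
      have odd: "sin (\<sigma> * x - \<sigma> * y) = \<sigma> * sin (x - y)" for x y
        using \<sigma> sin_minus[of "x - y"] by auto
      have "\<sigma> * \<sigma> = 1" using \<sigma> by auto
      then have s4: "\<sigma> * (\<sigma> * a) = a" for a :: real by (simp add: mult.assoc[symmetric])
      show ?thesis
        using that by (simp only: VS less_imp_le orient_cis odd v S0 less_imp_le_nat)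
          (simp add: s4 mult.left_commute mult.commute VS)
    qed
    finally show ?thesis using r by (simp add: zero_less_mult_iff)
  qed
  have Spos: "0 < S m" if "0 < m" "m < k" for m
  proof -
    \<comment> \<open>The vertex \<open>1 + m\<close> belongs to a triangle of \<open>tri\<close> as the start of a side, or, if it is the last
      one, as the end of a side.\<close>
    have "sin (S m) \<noteq> 0"
    proof (cases "Suc m < k")
      case True
      then show ?thesis using tri[of m] that by auto
    next
      case False
      then obtain n where "m = Suc n" "n > 0" using that k by (cases m) auto
      then show ?thesis using tri[of n] that by auto
    qed
    then show ?thesis using Sr(1)[OF that(2)] by (cases "S m = 0") auto
  qed
  have inc: "S m < S (Suc m)" if mk: "m < k" for m
  proof -
    consider "m = 0" | "Suc m = k" | "0 < m" "Suc m < k" using mk by linarith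
    then show ?thesis
    proof cases
      case 1
      then show ?thesis using Spos[of 1] S0 k by simp
    next
      case 2
      then show ?thesis using Sr[of m] mk Sk by simp
    next
      case 3
      have "0 < sin (S m)" "0 < sin (S (Suc m))"
        using Spos[of m] Spos[of "Suc m"] Sr[of m] Sr[of "Suc m"] 3 by (auto intro: sin_gt_zero)
      then have pos: "0 < sin (S (Suc m) - S m)" using tri[OF 3] by (simp add: zero_less_mult_iff)
      show ?thesis
      proof (rule ccontr)
        assume "\<not> S m < S (Suc m)"
        then have "0 \<le> sin (S m - S (Suc m))"
          using Sr[of m] Sr[of "Suc m"] 3 by (intro sin_ge_zero) auto
        then show False using pos sin_minus[of "S m - S (Suc m)"] by simp
      qed
    qed
  qed
  show ?thesis by (rule that[OF r v \<sigma> S0 Sk inc VS])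
qed

section \<open>Fixed points of the monodromy and related polygons\<close>

text \<open>On the unit circle \<open>t cnj F / F = t\<close> says that \<open>F = A + \<i> B (1 + \<delta> t)\<close> is real, and
  \<open>Im F = B (1 + \<delta> Re t)\<close> with \<open>B \<noteq> 0\<close>.\<close>

lemma monodromy_fixpoints_on_unit_circle:
  fixes V :: "int \<Rightarrow> complex"
  assumes cv: "convex_polygon k V" and circ: "\<forall>i. V i \<in> sphere c r" and l: "l > 0"
    and ne: "\<forall>i. l \<noteq> dist (V i) (V (i + 1))"
  obtains v where "norm v = 1" "r > 0" "V 1 = c + of_real r * v"
    "circle_fixpoints (monodromy k V l) = (\<lambda>t. v * t) ` {t \<in> sphere 0 1. Re t = - (l / (2 * r))}"
proof -
  obtain v \<sigma> S where r: "r > 0" and v: "norm v = 1" and \<sigma>: "\<sigma> \<in> {1, -1}"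
    and S: "S 0 = 0" "S k = pi" "\<And>m. m < k \<Longrightarrow> S m < S (Suc m)"
    and V: "\<And>m. m \<le> k \<Longrightarrow> V (1 + int m) = c + of_real r * (v * cis (2 * (\<sigma> * S m)))"
    using convex_cyclic_polygon_half_angles[OF cv circ] by metis
  have k: "k \<ge> 3" using cv by (simp add: convex_polygon_def)
  define \<delta> where "\<delta> = 2 * r / l"
  have \<delta>: "\<delta> > 0" using r l by (simp add: \<delta>_def)
  define P where "P = chord_coeffs (\<delta>\<^sup>2 - 1) (\<lambda>j. \<sigma> * S (Suc j) - \<sigma> * S j) k"
  have "snd P = \<sigma> * snd (chord_coeffs (\<delta>\<^sup>2 - 1) (\<lambda>j. S (Suc j) - S j) k)"
    using \<sigma> chord_coeffs_uminus[of "\<delta>\<^sup>2 - 1" "\<lambda>j. S (Suc j) - S j" k] by (auto simp: P_def)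
  moreover have "snd (chord_coeffs (\<delta>\<^sup>2 - 1) (\<lambda>j. S (Suc j) - S j) k) > 0"
    using \<delta> by (intro chord_coeffs_positive k S) auto
  ultimately have B: "snd P \<noteq> 0" using \<sigma> by auto
  have fixes_iff: "monodromy k V l (v * t) = v * t \<longleftrightarrow> Re t = - (l / (2 * r))"
    if t: "norm t = 1" for t
  proof -
    define F where "F = chord_factor \<delta> (fst P) (snd P) t"
    have "F \<noteq> 0 \<and> monodromy k V l (v * t) = v * cis (2 * (\<sigma> * S k)) * (t * cnj F / F)"
      unfolding monodromy_def F_def P_def \<delta>_def
      using S(1) ne by (intro fold_bicycle_maps_on_circle[where k = k and c = c and r = r] l r v t V) auto
    moreover have "cis (2 * (\<sigma> * S k)) = 1" using \<sigma> by (auto simp: S(2) complex_eq_iff)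
    moreover have "v \<noteq> 0" "t \<noteq> 0" using v t by auto
    ultimately have "monodromy k V l (v * t) = v * t \<longleftrightarrow> cnj F = F"
      by (auto simp: field_simps)
    also have "\<dots> \<longleftrightarrow> Im F = 0" by (auto simp: complex_eq_iff)
    also have "\<dots> \<longleftrightarrow> 1 + \<delta> * Re t = 0" using B by (simp add: F_def chord_factor_def)
    also have "\<dots> \<longleftrightarrow> Re t = - (l / (2 * r))"
      using l r by (auto simp: \<delta>_def field_simps)
    finally show ?thesis .
  qed
  have "circle_fixpoints (monodromy k V l) = (\<lambda>t. v * t) ` {t \<in> sphere 0 1. Re t = - (l / (2 * r))}"
  proof (intro equalityI subsetI)
    fix u assume u: "u \<in> circle_fixpoints (monodromy k V l)"
    have "v \<noteq> 0" using v by auto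
    then have "u = v * (u / v)" by simp
    moreover have "norm (u / v) = 1" using u v by (simp add: circle_fixpoints_def norm_divide)
    ultimately show "u \<in> (\<lambda>t. v * t) ` {t \<in> sphere 0 1. Re t = - (l / (2 * r))}"
      using u fixes_iff[of "u / v"] unfolding circle_fixpoints_def
      by (intro image_eqI[of _ _ "u / v"]) auto
  qed (use v fixes_iff in \<open>auto simp: circle_fixpoints_def norm_mult\<close>)
  moreover have "V 1 = c + of_real r * v" using V[of 0] S(1) by simp
  ultimately show ?thesis by (intro that[OF v r])
qed

lemma circle_inter_vertical_line:
  "{t \<in> sphere 0 1. Re t = x} = (if \<bar>x\<bar> \<le> 1 then {Complex x (sqrt (1 - x\<^sup>2)), Complex x (- sqrt (1 - x\<^sup>2))} else {})"
proof (cases "\<bar>x\<bar> \<le> 1")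
  case True
  then have x: "x\<^sup>2 \<le> 1" by (simp add: abs_square_le_1)
  have Im: "y\<^sup>2 = 1 - x\<^sup>2 \<longleftrightarrow> y = sqrt (1 - x\<^sup>2) \<or> y = - sqrt (1 - x\<^sup>2)" for y
    using x power2_eq_iff[of y "sqrt (1 - x\<^sup>2)"] by simp
  have "norm t = 1 \<longleftrightarrow> (Im t)\<^sup>2 = 1 - (Re t)\<^sup>2" for t
    by (auto simp: cmod_def)
  then have "norm t = 1 \<and> Re t = x \<longleftrightarrow> Re t = x \<and> (Im t = sqrt (1 - x\<^sup>2) \<or> Im t = - sqrt (1 - x\<^sup>2))" for t
    using Im[of "Im t"] by auto
  then have "t \<in> {t \<in> sphere 0 1. Re t = x} \<longleftrightarrow>
      t \<in> {Complex x (sqrt (1 - x\<^sup>2)), Complex x (- sqrt (1 - x\<^sup>2))}" for t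
    unfolding insert_iff complex_eq_iff by simp blast
  then show ?thesis
    unfolding if_P[OF True] by blast
next
  case False
  then have "Re t \<noteq> x" if "norm t = 1" for t
    using abs_Re_le_cmod[of t] that by auto
  then show ?thesis using False by auto
qed

text \<open>For \<open>Re t = -l/(2r)\<close> the factor \<open>E\<close> of each chord is real, so transport leaves \<open>t\<close> unchanged: in
  the rotating frame the bicycle is rigid.\<close>

lemma transport_chord_rotation:
  assumes l: "l > 0" and r: "r > 0"
    and P: "P \<in> sphere c r" and Q: "Q \<in> sphere c r" and ne: "dist P Q \<noteq> l"
    and t: "norm t = 1" "Re t = - (l / (2 * r))"
    and X: "X = P + of_real (l / r) * (t * (P - c))"
  shows "transport P Q X = Q + of_real (l / r) * (t * (Q - c))"
proof -
  define v where "v = (P - c) / of_real r"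
  define w where "w = (Q - c) / (P - c)"
  have nP: "norm (P - c) = r" "norm (Q - c) = r"
    using P Q by (auto simp: dist_norm norm_minus_commute)
  then have v: "norm v = 1" and w: "norm w = 1" and Pc: "P \<noteq> c"
    using r by (auto simp: v_def w_def norm_divide)
  obtain \<phi> where \<phi>: "w = cis (2 * \<phi>)"
    using complex_norm_eq_1_exp[of w] w by (metis cis_conv_exp mult.commute nonzero_mult_div_cancel_left zero_neq_numeral times_divide_eq_right)
  have P': "P = c + of_real r * v" using r by (simp add: v_def)
  have Q': "Q = c + of_real r * (v * cis (2 * \<phi>))"
    using r Pc by (simp add: v_def \<phi>[symmetric] w_def)
  define E where "E = chord_factor (2 * r / l) (cos \<phi>) (sin \<phi>) t"
  have "1 + 2 * r / l * Re t = 0" using l r t by simp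
  then have "cnj E = E"
    by (simp add: E_def chord_factor_def complex_eq_iff)
  moreover note bicycle_map_chord[OF l r v t(1), of c \<phi>, folded P' Q', OF ne, folded E_def]
  ultimately have "bicycle_map P Q l (v * t) = v * cis (2 * \<phi>) * t" by simp
  moreover have "P + l *\<^sub>R (v * t) = X" using r
    by (simp add: X v_def scaleR_conv_of_real mult_ac)
  ultimately have "(transport P Q X - Q) /\<^sub>R l = v * cis (2 * \<phi>) * t"
    by (simp add: bicycle_map_def)
  then have "transport P Q X = Q + l *\<^sub>R (v * cis (2 * \<phi>) * t)"
    using l by (metis (no_types, lifting) add_diff_cancel_left' diff_add_cancel add.commute less_irrefl pos_divideR_le_eq scaleR_one scaleR_scaleR right_inverse)
  also have "v * cis (2 * \<phi>) = (Q - c) / of_real r" using r by (simp add: Q')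
  finally show ?thesis using r by (simp add: scaleR_conv_of_real mult_ac)
qed

lemma monodromy_fixes_closed_image:
  assumes l: "l > 0" and W: "closed_polygon k W" and V: "closed_polygon k V"
    and rel: "bicycle_rel l V W"
  shows "(W 1 - V 1) /\<^sub>R l \<in> circle_fixpoints (monodromy k V l)"
proof -
  have "fold (\<lambda>i. bicycle_map (V i) (V (i + 1)) l) [1..int m] ((W 1 - V 1) /\<^sub>R l)
      = (W (1 + int m) - V (1 + int m)) /\<^sub>R l" for m
  proof (induction m)
    case (Suc m)
    have list: "[1..int (Suc m)] = [1..int m] @ [1 + int m]"
      using upto_rec2[of 1 "int (Suc m)"] by simp
    have "bicycle_map (V i) (V (i + 1)) l ((W i - V i) /\<^sub>R l) = (W (i + 1) - V (i + 1)) /\<^sub>R l" for i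
      using rel l by (simp add: bicycle_map_def bicycle_rel_def)
    from this[of "1 + int m"] show ?case
      unfolding list fold_append comp_def Suc by (simp add: add_ac)
  qed simp
  from this[of k] have "monodromy k V l ((W 1 - V 1) /\<^sub>R l) = (W 1 - V 1) /\<^sub>R l"
    using W V by (simp add: monodromy_def closed_polygon_def)
  moreover have "norm (W 1 - V 1) = l"
    using rel by (simp add: bicycle_rel_def dist_norm norm_minus_commute)
  ultimately show ?thesis using l by (simp add: circle_fixpoints_def)
qed

theorem theorem6:
  fixes V :: "int \<Rightarrow> complex" and k :: nat and c :: complex and r d l :: real
  assumes "convex_polygon k V"
    and "\<forall>i. V i \<in> sphere c r"
    and "d = 2 * r"
    and "l > 0"
    and "\<forall>i. l \<noteq> dist (V i) (V (i + 1))"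
  shows "(l > d \<longrightarrow> elliptic (monodromy k V l)) \<and>
         (l = d \<longrightarrow> parabolic (monodromy k V l)) \<and>
         (l < d \<longrightarrow> hyperbolic (monodromy k V l) \<and>
            (\<forall>W. closed_polygon k W \<and> bicycle_rel l V W \<longrightarrow>
               (\<exists>\<theta>. \<forall>i. W i = rotation_about c \<theta> (V i))))"
proof -
  obtain v where v: "norm v = 1" and r: "r > 0" and V1: "V 1 = c + of_real r * v"
    and fp: "circle_fixpoints (monodromy k V l) =
      (\<lambda>t. v * t) ` {t \<in> sphere 0 1. Re t = - (l / (2 * r))}"
    using monodromy_fixpoints_on_unit_circle[OF assms(1,2,4,5)] by metis
  have V: "closed_polygon k V" using assms(1) by (simp add: convex_polygon_def)
  define x where "x = - (l / (2 * r))"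
  have "inj_on (\<lambda>t. v * t) T" for T
    using v by (auto simp: inj_on_def)
  then have card: "card (circle_fixpoints (monodromy k V l)) = card {t \<in> sphere 0 1. Re t = x}"
    unfolding fp x_def by (rule card_image)
  have "elliptic (monodromy k V l)" if "l > d"
  proof -
    have "\<not> \<bar>x\<bar> \<le> 1" using that r assms(3,4) by (simp add: x_def field_simps)
    then show ?thesis
      unfolding elliptic_def fp x_def[symmetric] circle_inter_vertical_line by simp
  qed
  moreover have "parabolic (monodromy k V l)" if "l = d"
  proof -
    have "x = -1" using that r assms(3) by (simp add: x_def)
    then show ?thesis unfolding parabolic_def card circle_inter_vertical_line by simp
  qed
  moreover have "hyperbolic (monodromy k V l)" if "l < d"
  proof -
    have x: "\<bar>x\<bar> < 1" using that r assms(3,4) by (simp add: x_def field_simps)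
    then have "x\<^sup>2 < 1" by (simp add: abs_square_less_1)
    then show ?thesis using x unfolding hyperbolic_def card circle_inter_vertical_line by simp
  qed
  moreover have "\<exists>\<theta>. \<forall>i. W i = rotation_about c \<theta> (V i)"
    if W: "closed_polygon k W" and rel: "bicycle_rel l V W" for W
  proof -
    obtain t where t: "norm t = 1" "Re t = - (l / (2 * r))" and "(W 1 - V 1) /\<^sub>R l = v * t"
      using monodromy_fixes_closed_image[OF assms(4) W V rel] unfolding fp by auto
    then have "W 1 - V 1 = l *\<^sub>R (v * t)" using assms(4) by (metis less_irrefl scaleR_one scaleR_scaleR right_inverse)
    then have W1: "W 1 = V 1 + of_real (l / r) * (t * (V 1 - c))"
      using r unfolding V1 by (simp add: scaleR_conv_of_real algebra_simps)
    have nat: "W (1 + int m) = V (1 + int m) + of_real (l / r) * (t * (V (1 + int m) - c))" for m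
    proof (induction m)
      case (Suc m)
      have "W (1 + int m + 1) = transport (V (1 + int m)) (V (1 + int m + 1)) (W (1 + int m))"
        using rel unfolding bicycle_rel_def by blast
      also have "\<dots> = V (1 + int m + 1) + of_real (l / r) * (t * (V (1 + int m + 1) - c))"
        using assms(2,5) by (intro transport_chord_rotation[OF assms(4) r _ _ _ t Suc]) (metis | blast)+
      finally show ?case by (simp add: add_ac)
    qed (simp add: W1)
    have per: "U (i + int n * int k) = U i" if "closed_polygon k U" for U :: "int \<Rightarrow> complex" and i n
    proof (induction n)
      case (Suc n)
      have "U (i + int (Suc n) * int k) = U ((i + int n * int k) + int k)"
        by (simp add: algebra_simps)
      also have "\<dots> = U (i + int n * int k)"
        using that unfolding closed_polygon_def by blast
      finally show ?case using Suc by simp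
    qed simp
    \<comment> \<open>Every index becomes positive after adding a multiple of the period.\<close>
    have all: "W i = V i + of_real (l / r) * (t * (V i - c))" for i
    proof -
      have "1 \<le> int k" using V by (simp add: closed_polygon_def)
      then have "int (nat \<bar>i - 1\<bar>) * 1 \<le> int (nat \<bar>i - 1\<bar>) * int k" by (intro mult_left_mono) auto
      then have "1 \<le> i + int (nat \<bar>i - 1\<bar>) * int k" by linarith
      then obtain m where "i + int (nat \<bar>i - 1\<bar>) * int k = 1 + int m"
        using zle_iff_zadd by auto
      then show ?thesis using nat[of m] per[OF V, of i] per[OF W, of i] by metis
    qed
    define q where "q = 1 + of_real (l / r) * t"
    have q: "norm q = 1"
    proof -
      have "(Re t)\<^sup>2 + (Im t)\<^sup>2 = 1" using t(1) by (simp add: cmod_def)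
      then have "(1 + a * Re t)\<^sup>2 + (a * Im t)\<^sup>2 = 1 + 2 * a * Re t + a\<^sup>2" for a
        by algebra
      from this[of "l / r"] have "(norm q)\<^sup>2 = 1 + 2 * (l / r) * Re t + (l / r)\<^sup>2"
        unfolding cmod_power2 q_def by simp
      also have "\<dots> = 1" using r by (simp add: t(2) power2_eq_square)
      finally show ?thesis using norm_ge_zero[of q] by (auto simp: power2_eq_1_iff)
    qed
    have "q \<noteq> 0" using q by auto
    then have "cis (Arg q) = q" using q cis_Arg[of q] by (simp add: sgn_div_norm)
    then have "W i = rotation_about c (Arg q) (V i)" for i
      unfolding rotation_about_def all[of i] by (simp add: q_def algebra_simps add_divide_distrib diff_divide_distrib)
    then show ?thesis by blast
  qed
  ultimately show ?thesis by blast
qed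

end
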